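(* Suppose that the steady-state angles $\theta^\star_{jk}$, set-points $p_k^\star,q_k^\star\in\mathbb{R}$, $v_k^\star\in\mathbb{R}_{>0}$, and steady-state branch powers $p^\star_{jk},q^\star_{jk}$ are consistent (as defined in the context), that $|\theta^\star_{jk}|\le\frac{\pi}{2}$ for all $(j,k)\in\mathcal{N}\times\mathcal{N}$, and that for all $k\in\mathcal{N}$ the stability margin $c\in\mathbb{R}_{>0}$, the network parameters $\|Y_{jk}\|$, and the gains $\eta,\alpha\in\mathbb{R}_{>0}$ satisfy $$\sum_{j:(j,k)\in\mathcal{E}}\left(\frac{\cos(\kappa)}{v_k^{\star2}}|p^\star_{jk}|+\frac{\sin(\kappa)}{v_k^{\star2}}|q^\star_{jk}|\right)+\alpha<\frac{v_{\min}^{\star2}}{2v_{\max}^{\star2}}\lambda_2(L)-c,$$ $$\eta<\frac{c}{2\rho d_{\max}\big(c+5\max_{k\in\mathcal{N}}s_k^\star (v_k^{\star})^{-2}+10d_{\max}\big)},$$ where $s_k^\star:=\sqrt{p_k^{\star2}+q_k^{\star2}}$ and $d_{\max}:=\max_{k\in\mathcal{N}}\sum_{j:(j,k)\in\mathcal{E}}\|Y_{jk}\|$. Then the Stability Condition (as defined in the context) is satisfied.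
   Context: Network: $\mathcal{G}$ is a simple undirected graph with nodes $\mathcal{N}=\{1,\dots,N\}$ and $M$ edges $\mathcal{E}$ (transmission lines); for fixed $k$, sums over $(j,k)\in\mathcal{E}$ run over the neighbors $j$ of $k$. Line $l$ has resistance $r_l>0$ and inductance $\ell_l>0$; $\omega_0\ge0$ is the nominal frequency. Standing assumption: $\ell_l/r_l=\rho>0$ is the same for all lines. The edge weight of line $l$ is $\|Y_l\|=1/\sqrt{r_l^2+\omega_0^2\ell_l^2}$; $r_{jk},\ell_{jk},\|Y_{jk}\|$ denote the quantities of the line joining $j$ and $k$. Matrices: $R(\theta)=\begin{bmatrix}\cos\theta&-\sin\theta\\ \sin\theta&\cos\theta\end{bmatrix}$, $J=R(\pi/2)$; $B\in\{-1,0,1\}^{N\times M}$ is the oriented incidence matrix, $\mathcal{B}=B\otimes I_2$; $R_T=\mathrm{diag}(\{r_l\})\otimes I_2$, $L_T=\mathrm{diag}(\{\ell_l\})\otimes I_2$, $Z_T=R_T+\omega_0(I_M\otimes J)L_T$; $\mathcal{Y}=\mathcal{B}Z_T^{-1}\mathcal{B}^{\mathsf T}$; $\kappa=\tan^{-1}(\rho\omega_0)$; $L=B\,\mathrm{diag}(\{\|Y_l\|\}_{l=1}^M)B^{\mathsf T}$ with second smallest eigenvalue $\lambda_2(L)$, $\mathcal{L}=L\otimes I_2$. Matrix norms are induced 2-norms. $\mathcal{K}=\mathrm{diag}(\{K_k\}_{k=1}^N)$ (block diagonal) with $K_k=\frac{1}{v_k^{\star2}}R(\kappa)\begin{bmatrix}p_k^\star&q_k^\star\\-q_k^\star&p_k^\star\end{bmatrix}$.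 $v^\star_{\min}=\min_kv_k^\star$, $v^\star_{\max}=\max_kv_k^\star$. Angles and consistency: steady-state angles are given by $\theta^\star_{k1}$, $k\in\mathcal{N}$, with $\theta^\star_{11}=0$, and $\theta^\star_{jk}:=\theta^\star_{j1}-\theta^\star_{k1}$. The set-points, angles and branch powers are consistent if $\theta^\star_{jk}\in(-\pi,\pi]$ and $$p^\star_{jk}=\|Y_{jk}\|^2\big(v_k^{\star2}r_{jk}-v_k^\star v_j^\star(r_{jk}\cos\theta^\star_{jk}+\omega_0\ell_{jk}\sin\theta^\star_{jk})\big),$$ $$q^\star_{jk}=\|Y_{jk}\|^2\big(v_k^{\star2}\omega_0\ell_{jk}-v_k^\star v_j^\star(\omega_0\ell_{jk}\cos\theta^\star_{jk}-r_{jk}\sin\theta^\star_{jk})\big)$$ for $(j,k)\in\mathcal{E}$, and $p_k^\star=\sum_{(j,k)\in\mathcal{E}}p^\star_{jk}$, $q_k^\star=\sum_{(j,k)\in\mathcal{E}}q_{jk}^\star$ for all $k\in\mathcal{N}$. Stability Condition (on $p_k^\star,q_k^\star,v_k^\star,\theta_{jk}^\star,c,\alpha,\eta$): the set-points and angles are consistent; there exists $\bar\theta^\star\in[0,\frac{\pi}{2}]$ such that $|\theta^\star_{jk}|\le\bar\theta^\star$ for all $(j,k)\in\mathcal{N}\times\mathcal{N}$; and for all $k\in\mathcal{N}$, $$\sum_{j:(j,k)\in\mathcal{E}}\|Y_{jk}\|\left|1-\frac{v_j^\star}{v_k^\star}\cos(\theta^\star_{jk})\right|+\alpha<\frac{1+\cos(\bar\theta^\star)}{2}\frac{v_{\min}^{\star2}}{v_{\max}^{\star2}}\lambda_2(L)-c,\qquad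 \eta<\frac{c}{\rho\|\mathcal{Y}\|(c+5\|\mathcal{K}-\mathcal{L}\|)}.$$ *)

theory Defs
  imports "HOL-Analysis.Analysis" "HOL-Computational_Algebra.Polynomial"
begin

definition diag_matrix :: "('n \<Rightarrow> real) \<Rightarrow> real ^ 'n ^ ('n::finite)" where
  "diag_matrix d = (\<chi> i j. if i = j then d i else 0)"

text \<open>Index pairs are (outer, inner), so the blocks of the product are indexed by the first
  components.\<close>

definition kron ::
    "real ^ 'b ^ 'a \<Rightarrow> real ^ 'd ^ 'c \<Rightarrow> real ^ ('b::finite \<times> 'd::finite) ^ ('a::finite \<times> 'c::finite)"
    (infixl \<open>\<otimes>\<^sub>K\<close> 75) where
  "A \<otimes>\<^sub>K C = (\<chi> i j. A $ fst i $ fst j * C $ snd i $ snd j)"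

definition block_diag ::
    "('n \<Rightarrow> real ^ 'd ^ 'd) \<Rightarrow> real ^ ('n::finite \<times> 'd::finite) ^ ('n \<times> 'd)" where
  "block_diag D = (\<chi> i j. if fst i = fst j then D (fst i) $ snd i $ snd j else 0)"

definition norm2 :: "real ^ 'n::finite ^ 'm::finite \<Rightarrow> real" where
  "norm2 A = onorm ((*v) A)"

definition charpoly :: "real ^ 'n ^ 'n::finite \<Rightarrow> real poly" where
  "charpoly A = det (\<chi> i j. (if i = j then [:0, 1:] else 0) - [:A $ i $ j:])"

text \<open>The eigenvalues are counted with algebraic multiplicity. The definition is meant for
  symmetric matrices of size at least 2, whose characteristic polynomial splits over the reals.\<close>

definition lambda2 :: "real ^ 'n ^ 'n::finite \<Rightarrow> real" where
  "lambda2 A = sorted_list_of_multiset (proots (charpoly A)) ! 1"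

definition rot :: "real \<Rightarrow> real ^ 2 ^ 2" where
  "rot \<phi> = vector [vector [cos \<phi>, - sin \<phi>], vector [sin \<phi>, cos \<phi>]]"

definition J2 :: "real ^ 2 ^ 2" where
  "J2 = rot (pi / 2)"

text \<open>The nodes are the elements of the finite type \<open>'n\<close> and the lines those of the finite type
  \<open>'m\<close>. Line \<open>l\<close> joins \<open>tail_node G l\<close> and \<open>head_node G l\<close>; which end is the tail is an
  arbitrary choice of orientation. \<open>ref_node\<close> is the node whose angle is set to zero.\<close>

record ('n, 'm) network =
  tail_node :: "'m \<Rightarrow> 'n"
  head_node :: "'m \<Rightarrow> 'n"
  ref_node :: 'n
  resistance :: "'m \<Rightarrow> real"
  inductance :: "'m \<Rightarrow> real"
  freq :: real
  rho :: real

text \<open>Types are nonempty, so there is a line; as its ends differ, there are two nodes or more and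
  the second smallest eigenvalue of the Laplacian is meaningful.\<close>

definition network :: "('n::finite, 'm::finite) network \<Rightarrow> bool" where
  "network G \<longleftrightarrow>
     (\<forall>l. tail_node G l \<noteq> head_node G l) \<and>
     inj (\<lambda>l. {tail_node G l, head_node G l}) \<and>
     (\<forall>l. resistance G l > 0 \<and> inductance G l > 0) \<and>
     freq G \<ge> 0 \<and> rho G > 0 \<and>
     (\<forall>l. inductance G l / resistance G l = rho G)"

definition joins :: "('n, 'm) network \<Rightarrow> 'm \<Rightarrow> 'n \<Rightarrow> 'n \<Rightarrow> bool" where
  "joins G l j k \<longleftrightarrow> {tail_node G l, head_node G l} = {j, k}"

definition adjacent :: "('n, 'm) network \<Rightarrow> 'n \<Rightarrow> 'n \<Rightarrow> bool" where
  "adjacent G j k \<longleftrightarrow> (\<exists>l. joins G l j k)"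

definition nbrs :: "('n, 'm) network \<Rightarrow> 'n \<Rightarrow> 'n set" where
  "nbrs G k = {j. adjacent G j k}"

definition line_of :: "('n, 'm) network \<Rightarrow> 'n \<Rightarrow> 'n \<Rightarrow> 'm" where
  "line_of G j k = (THE l. joins G l j k)"

definition weight :: "('n, 'm) network \<Rightarrow> 'm \<Rightarrow> real" where
  "weight G l = 1 / sqrt ((resistance G l)\<^sup>2 + (freq G)\<^sup>2 * (inductance G l)\<^sup>2)"

abbreviation r_edge :: "('n, 'm) network \<Rightarrow> 'n \<Rightarrow> 'n \<Rightarrow> real" where
  "r_edge G j k \<equiv> resistance G (line_of G j k)"

abbreviation l_edge :: "('n, 'm) network \<Rightarrow> 'n \<Rightarrow> 'n \<Rightarrow> real" where
  "l_edge G j k \<equiv> inductance G (line_of G j k)"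

abbreviation Y_edge :: "('n, 'm) network \<Rightarrow> 'n \<Rightarrow> 'n \<Rightarrow> real" where
  "Y_edge G j k \<equiv> weight G (line_of G j k)"

definition kappa :: "('n, 'm) network \<Rightarrow> real" where
  "kappa G = arctan (rho G * freq G)"

definition d_max :: "('n::finite, 'm) network \<Rightarrow> real" where
  "d_max G = Max (range (\<lambda>k. \<Sum>j\<in>nbrs G k. Y_edge G j k))"

definition incidence :: "('n::finite, 'm::finite) network \<Rightarrow> real ^ 'm ^ 'n" where
  "incidence G = (\<chi> k l. if k = head_node G l then 1 else if k = tail_node G l then - 1 else 0)"

definition incidence2 :: "('n::finite, 'm::finite) network \<Rightarrow> real ^ ('m \<times> 2) ^ ('n \<times> 2)" where
  "incidence2 G = incidence G \<otimes>\<^sub>K mat 1"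

definition R_T :: "('n::finite, 'm::finite) network \<Rightarrow> real ^ ('m \<times> 2) ^ ('m \<times> 2)" where
  "R_T G = diag_matrix (resistance G) \<otimes>\<^sub>K mat 1"

definition L_T :: "('n::finite, 'm::finite) network \<Rightarrow> real ^ ('m \<times> 2) ^ ('m \<times> 2)" where
  "L_T G = diag_matrix (inductance G) \<otimes>\<^sub>K mat 1"

definition Z_T :: "('n::finite, 'm::finite) network \<Rightarrow> real ^ ('m \<times> 2) ^ ('m \<times> 2)" where
  "Z_T G = R_T G + freq G *\<^sub>R (((mat 1 :: real ^ 'm ^ 'm) \<otimes>\<^sub>K J2) ** L_T G)"

definition admittance :: "('n::finite, 'm::finite) network \<Rightarrow> real ^ ('n \<times> 2) ^ ('n \<times> 2)" where
  "admittance G = incidence2 G ** matrix_inv (Z_T G) ** transpose (incidence2 G)"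

definition laplacian :: "('n::finite, 'm::finite) network \<Rightarrow> real ^ 'n ^ 'n" where
  "laplacian G = incidence G ** diag_matrix (weight G) ** transpose (incidence G)"

definition laplacian2 :: "('n::finite, 'm::finite) network \<Rightarrow> real ^ ('n \<times> 2) ^ ('n \<times> 2)" where
  "laplacian2 G = laplacian G \<otimes>\<^sub>K mat 1"

text \<open>In what follows \<open>p\<close>, \<open>q\<close>, \<open>v\<close> are the power and voltage set-points of the nodes,
  \<open>\<theta> k\<close> is the angle of node \<open>k\<close> relative to the reference node, and \<open>P j k\<close>, \<open>Q j k\<close> are
  the branch powers, relevant only for adjacent \<open>j\<close> and \<open>k\<close>.\<close>

definition angle :: "('n \<Rightarrow> real) \<Rightarrow> 'n \<Rightarrow> 'n \<Rightarrow> real" where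
  "angle \<theta> j k = \<theta> j - \<theta> k"

definition v_min :: "('n::finite \<Rightarrow> real) \<Rightarrow> real" where
  "v_min v = Min (range v)"

definition v_max :: "('n::finite \<Rightarrow> real) \<Rightarrow> real" where
  "v_max v = Max (range v)"

definition K_node :: "('n, 'm) network \<Rightarrow> ('n \<Rightarrow> real) \<Rightarrow> ('n \<Rightarrow> real) \<Rightarrow> ('n \<Rightarrow> real) \<Rightarrow> 'n \<Rightarrow> real ^ 2 ^ 2" where
  "K_node G p q v k =
     (1 / (v k)\<^sup>2) *\<^sub>R (rot (kappa G) ** vector [vector [p k, q k], vector [- q k, p k]])"

definition K_matrix ::
    "('n::finite, 'm) network \<Rightarrow> ('n \<Rightarrow> real) \<Rightarrow> ('n \<Rightarrow> real) \<Rightarrow> ('n \<Rightarrow> real) \<Rightarrow> real ^ ('n \<times> 2) ^ ('n \<times> 2)" where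
  "K_matrix G p q v = block_diag (K_node G p q v)"

definition consistent ::
    "('n, 'm) network \<Rightarrow> ('n \<Rightarrow> real) \<Rightarrow> ('n \<Rightarrow> real) \<Rightarrow> ('n \<Rightarrow> real) \<Rightarrow> ('n \<Rightarrow> real) \<Rightarrow>
     ('n \<Rightarrow> 'n \<Rightarrow> real) \<Rightarrow> ('n \<Rightarrow> 'n \<Rightarrow> real) \<Rightarrow> bool" where
  "consistent G p q v \<theta> P Q \<longleftrightarrow>
     \<theta> (ref_node G) = 0 \<and>
     (\<forall>j k. angle \<theta> j k \<in> {- pi <.. pi}) \<and>
     (\<forall>j k. adjacent G j k \<longrightarrow>
        P j k = (Y_edge G j k)\<^sup>2 *
          ((v k)\<^sup>2 * r_edge G j k
           - v k * v j * (r_edge G j k * cos (angle \<theta> j k)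
                          + freq G * l_edge G j k * sin (angle \<theta> j k))) \<and>
        Q j k = (Y_edge G j k)\<^sup>2 *
          ((v k)\<^sup>2 * freq G * l_edge G j k
           - v k * v j * (freq G * l_edge G j k * cos (angle \<theta> j k)
                          - r_edge G j k * sin (angle \<theta> j k)))) \<and>
     (\<forall>k. p k = (\<Sum>j\<in>nbrs G k. P j k) \<and> q k = (\<Sum>j\<in>nbrs G k. Q j k))"

definition stability_condition ::
    "('n::finite, 'm::finite) network \<Rightarrow> ('n \<Rightarrow> real) \<Rightarrow> ('n \<Rightarrow> real) \<Rightarrow> ('n \<Rightarrow> real) \<Rightarrow> ('n \<Rightarrow> real) \<Rightarrow>
     real \<Rightarrow> real \<Rightarrow> real \<Rightarrow> bool" where
  "stability_condition G p q v \<theta> c \<alpha> \<eta> \<longleftrightarrow>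
     (\<exists>P Q. consistent G p q v \<theta> P Q) \<and>
     (\<exists>\<theta>'. 0 \<le> \<theta>' \<and> \<theta>' \<le> pi / 2 \<and>
        (\<forall>j k. \<bar>angle \<theta> j k\<bar> \<le> \<theta>') \<and>
        (\<forall>k. (\<Sum>j\<in>nbrs G k. Y_edge G j k * \<bar>1 - v j / v k * cos (angle \<theta> j k)\<bar>) + \<alpha>
              < (1 + cos \<theta>') / 2 * ((v_min v)\<^sup>2 / (v_max v)\<^sup>2) * lambda2 (laplacian G) - c)) \<and>
     \<eta> < c / (rho G * norm2 (admittance G) * (c + 5 * norm2 (K_matrix G p q v - laplacian2 G)))"

end

theory Submission
  imports Defs
begin

text \<open>
  The choice \<open>\<theta>' = \<pi>/2\<close> makes the factor \<open>1 + cos \<theta>'\<close> equal to 1, and since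
  \<open>\<parallel>Y\<parallel> r = cos \<kappa>\<close> and \<open>\<parallel>Y\<parallel> \<omega>\<^sub>0 l = sin \<kappa>\<close> on every line, the combination
  \<open>cos \<kappa> p + sin \<kappa> q\<close> of the branch powers is \<open>\<parallel>Y\<parallel> (v\<^sub>k\<^sup>2 - v\<^sub>k v\<^sub>j cos \<theta>)\<close>.
  For the bound on \<open>\<eta>\<close>, uniformity of the ratio of inductance to resistance gives
  \<open>Z_T = diag (1 / \<parallel>Y\<parallel>) \<otimes> R(\<kappa>)\<close>, so the admittance matrix is \<open>L \<otimes> R(-\<kappa>)\<close>. The Schur test
  bounds its norm and that of \<open>L \<otimes> I\<close> by \<open>2 d_max\<close>, and each block of \<open>K\<close> is a rotation
  scaled by \<open>s\<^sub>k / v\<^sub>k\<^sup>2\<close>.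
\<close>

section \<open>Kronecker products, block diagonal matrices and rotations\<close>

lemma sum_UNIV_prod:
  "(\<Sum>z\<in>(UNIV :: ('a::finite \<times> 'b::finite) set). f z) = (\<Sum>x\<in>UNIV. \<Sum>y\<in>UNIV. f (x, y))"
  unfolding UNIV_Times_UNIV[symmetric] by (rule sum.cartesian_product')

lemma kron_mult: "(A \<otimes>\<^sub>K B) ** (C \<otimes>\<^sub>K D) = (A ** C) \<otimes>\<^sub>K (B ** D)"
  by (simp add: vec_eq_iff kron_def matrix_matrix_mult_def sum_UNIV_prod sum_product
      mult_ac)

lemma transpose_kron: "transpose (A \<otimes>\<^sub>K B) = transpose A \<otimes>\<^sub>K transpose B"
  by (simp add: vec_eq_iff kron_def transpose_def)

lemma kron_mat_1: "mat 1 \<otimes>\<^sub>K mat 1 = mat 1"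
  by (auto simp: vec_eq_iff kron_def mat_def prod_eq_iff)

lemma mat_1_kron: "mat 1 \<otimes>\<^sub>K D = block_diag (\<lambda>_. D)"
  by (simp add: vec_eq_iff kron_def block_diag_def mat_def)

lemma diag_matrix_mult: "diag_matrix a ** diag_matrix b = diag_matrix (\<lambda>i. a i * b i)"
  by (simp add: vec_eq_iff diag_matrix_def matrix_matrix_mult_def if_distrib[of "\<lambda>x. x * _"]
      if_distrib[of "\<lambda>x. _ * x"] cong: if_cong)

lemma rot_inverse: "rot x ** rot (- x) = mat 1"
  using sin_cos_squared_add[of x]
  by (simp add: rot_def vec_eq_iff matrix_matrix_mult_def mat_def sum_2 forall_2 power2_eq_square)

section \<open>Bounds for the induced 2-norm\<close>

lemma norm_sq_vec: "(norm (x :: real ^ 'n::finite))\<^sup>2 = (\<Sum>i\<in>UNIV. (x $ i)\<^sup>2)"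
  by (simp add: norm_vec_def L2_set_def sum_nonneg)

lemma norm2_le:
  assumes "C \<ge> 0" "\<And>x. (norm (A *v x))\<^sup>2 \<le> C\<^sup>2 * (norm x)\<^sup>2"
  shows "norm2 A \<le> C"
  unfolding norm2_def
proof (rule onorm_le)
  fix x
  show "norm (A *v x) \<le> C * norm x"
    by (rule power2_le_imp_le) (use assms in \<open>auto simp: power_mult_distrib\<close>)
qed

lemma norm2_nonneg: "norm2 A \<ge> 0"
  by (simp add: norm2_def onorm_pos_le)

lemma norm2_pos_iff: "norm2 A > 0 \<longleftrightarrow> A \<noteq> 0"
  by (auto simp: norm2_def onorm_pos_lt matrix_eq)

lemma norm2_diff_le: "norm2 (A - B) \<le> norm2 A + norm2 B"
proof -
  have "(*v) (A - B) = (\<lambda>x. A *v x + - (B *v x))"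
    by (simp add: fun_eq_iff matrix_vector_mult_diff_rdistrib)
  then show ?thesis
    unfolding norm2_def
    using onorm_triangle[of "(*v) A" "\<lambda>x. - (B *v x)"]
    by (simp add: onorm_neg bounded_linear_minus)
qed

lemma norm2_mult_le: "norm2 (A ** B) \<le> norm2 A * norm2 B"
proof -
  have "(*v) (A ** B) = (*v) A \<circ> (*v) B"
    by (simp add: fun_eq_iff matrix_vector_mul_assoc)
  then show ?thesis
    unfolding norm2_def by (simp add: onorm_compose)
qed

text \<open>Cauchy-Schwarz splits each entry into two square roots of its absolute value. The row
  sums bound one factor and, after exchanging the sums, the column sums bound the other.\<close>

lemma norm2_schur:
  assumes row: "\<And>i. (\<Sum>j\<in>UNIV. \<bar>A $ i $ j\<bar>) \<le> C" and col: "\<And>j. (\<Sum>i\<in>UNIV. \<bar>A $ i $ j\<bar>) \<le> C"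
  shows "norm2 A \<le> C"
proof (rule norm2_le)
  show C: "C \<ge> 0"
    by (rule order_trans[OF sum_nonneg row]) simp
  fix x
  have "((A *v x) $ i)\<^sup>2 \<le> C * (\<Sum>j\<in>UNIV. \<bar>A $ i $ j\<bar> * (x $ j)\<^sup>2)" for i
  proof -
    \<comment> \<open>The sign is attached to \<open>x\<close>, where squaring removes it:
      \<open>sgn\<close> is 0 only when the entry, and with it the square root, vanishes.\<close>
    have "((A *v x) $ i)\<^sup>2
        = (\<Sum>j\<in>UNIV. sqrt \<bar>A $ i $ j\<bar> * (sqrt \<bar>A $ i $ j\<bar> * (sgn (A $ i $ j) * x $ j)))\<^sup>2"
      by (simp add: matrix_vector_mult_def abs_mult_sgn flip: mult.assoc)
    also have "\<dots> \<le> (\<Sum>j\<in>UNIV. (sqrt \<bar>A $ i $ j\<bar>)\<^sup>2)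
        * (\<Sum>j\<in>UNIV. (sqrt \<bar>A $ i $ j\<bar> * (sgn (A $ i $ j) * x $ j))\<^sup>2)"
      by (rule Cauchy_Schwarz_ineq_sum)
    also have "(\<Sum>j\<in>UNIV. (sqrt \<bar>A $ i $ j\<bar> * (sgn (A $ i $ j) * x $ j))\<^sup>2)
        = (\<Sum>j\<in>UNIV. \<bar>A $ i $ j\<bar> * (x $ j)\<^sup>2)"
      by (intro sum.cong) (auto simp: power_mult_distrib sgn_if)
    also have "(\<Sum>j\<in>UNIV. (sqrt \<bar>A $ i $ j\<bar>)\<^sup>2) * \<dots> \<le> C * \<dots>"
      using row[of i] by (intro mult_right_mono sum_nonneg) auto
    finally show ?thesis .
  qed
  then have "(norm (A *v x))\<^sup>2 \<le> (\<Sum>i\<in>UNIV. C * (\<Sum>j\<in>UNIV. \<bar>A $ i $ j\<bar> * (x $ j)\<^sup>2))"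
    unfolding norm_sq_vec by (intro sum_mono)
  also have "\<dots> = C * (\<Sum>i\<in>UNIV. \<Sum>j\<in>UNIV. \<bar>A $ i $ j\<bar> * (x $ j)\<^sup>2)"
    by (simp add: sum_distrib_left)
  also have "\<dots> = C * (\<Sum>j\<in>UNIV. \<Sum>i\<in>UNIV. \<bar>A $ i $ j\<bar> * (x $ j)\<^sup>2)"
    by (subst sum.swap) simp
  also have "\<dots> = C * (\<Sum>j\<in>UNIV. (\<Sum>i\<in>UNIV. \<bar>A $ i $ j\<bar>) * (x $ j)\<^sup>2)"
    by (simp add: sum_distrib_right)
  also have "\<dots> \<le> C * (\<Sum>j\<in>UNIV. C * (x $ j)\<^sup>2)"
    using col C by (intro mult_left_mono sum_mono mult_right_mono) auto
  also have "\<dots> = C\<^sup>2 * (norm x)\<^sup>2"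
    by (simp add: norm_sq_vec sum_distrib_left power2_eq_square[of C] mult.assoc)
  finally show "(norm (A *v x))\<^sup>2 \<le> C\<^sup>2 * (norm x)\<^sup>2" .
qed

text \<open>Tensoring with the identity only pads the rows and columns of \<open>A\<close> with
  zeros, so its absolute row and column sums carry over.\<close>

lemma norm2_kron_mat_1:
  fixes A :: "real ^ 'n::finite ^ 'm::finite"
  assumes "\<And>i. (\<Sum>j\<in>UNIV. \<bar>A $ i $ j\<bar>) \<le> C" "\<And>j. (\<Sum>i\<in>UNIV. \<bar>A $ i $ j\<bar>) \<le> C"
  shows "norm2 (A \<otimes>\<^sub>K (mat 1 :: real ^ 'd::finite ^ 'd)) \<le> C"
  by (rule norm2_schur)
    (simp_all add: kron_def mat_def abs_mult sum_UNIV_prod assms if_distrib[of abs]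
        if_distrib[of "\<lambda>x. _ * x"] cong: if_cong)

text \<open>Squared norms add up over the blocks, and each block of the image depends only on the
  same block of the argument.\<close>

lemma norm2_block_diag:
  fixes D :: "'n::finite \<Rightarrow> real ^ 'd::finite ^ 'd"
  assumes "C \<ge> 0" "\<And>k y. (norm (D k *v y))\<^sup>2 \<le> C\<^sup>2 * (norm y)\<^sup>2"
  shows "norm2 (block_diag D) \<le> C"
proof (rule norm2_le)
  fix x :: "real ^ ('n \<times> 'd)"
  define b where "b z k = (\<chi> a. z $ (k, a))" for z :: "real ^ ('n \<times> 'd)" and k
  have norm_b: "(norm z)\<^sup>2 = (\<Sum>k\<in>UNIV. (norm (b z k))\<^sup>2)" for z
    by (simp add: norm_sq_vec b_def sum_UNIV_prod)
  \<comment> \<open>The block test does not involve the inner index; moving it out of the inner sum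
    lets the outer sum collapse to a single block.\<close>
  have if_zero: "(\<Sum>y\<in>A. if Q then f y else 0) = (if Q then sum f A else 0)"
    for A :: "'d set" and Q and f :: "'d \<Rightarrow> real"
    by simp
  have "b (block_diag D *v x) k = D k *v b x k" for k
    by (simp add: vec_eq_iff b_def block_diag_def matrix_vector_mult_def sum_UNIV_prod
        if_distrib[of "\<lambda>x. x * _"] if_zero cong: if_cong)
  then show "(norm (block_diag D *v x))\<^sup>2 \<le> C\<^sup>2 * (norm x)\<^sup>2"
    unfolding norm_b sum_distrib_left using assms(2) by (auto intro: sum_mono)
qed fact

text \<open>The matrix is a rotation scaled by \<open>sqrt (a\<^sup>2 + b\<^sup>2)\<close>, so the
  cross terms cancel.\<close>

lemma norm_scaled_rotation_mult:
  fixes y :: "real ^ 2"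
  shows "(norm ((vector [vector [a, b], vector [- b, a]] :: real ^ 2 ^ 2) *v y))\<^sup>2 = (a\<^sup>2 + b\<^sup>2) * (norm y)\<^sup>2"
  unfolding norm_sq_vec by (simp add: matrix_vector_mult_def sum_2 power2_eq_square algebra_simps)

section \<open>Line parameters and branch powers\<close>

lemma joins_line_of:
  assumes "network G" "joins G l j k"
  shows "line_of G j k = l"
proof -
  have "inj (\<lambda>l. {tail_node G l, head_node G l})"
    using assms(1) by (simp add: network_def)
  then show ?thesis
    using assms(2) unfolding line_of_def joins_def by (metis (mono_tags, lifting) injD the_equality)
qed

lemma weight_pos:
  assumes "network G"
  shows "weight G l > 0"
proof -
  have "resistance G l > 0"
    using assms by (simp add: network_def)
  then show ?thesis
    by (simp add: weight_def add_pos_nonneg)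
qed

lemma cos_kappa_pos: "cos (kappa G) > 0"
  by (simp add: kappa_def cos_arctan add_pos_nonneg)

lemma sin_kappa_nonneg: "network G \<Longrightarrow> sin (kappa G) \<ge> 0"
  by (simp add: kappa_def sin_arctan network_def)

text \<open>As inductance is \<open>rho G\<close> times resistance, the resistance factors out of
  the modulus of the impedance and leaves the root \<open>sqrt (1 + t\<^sup>2)\<close> that occurs
  in the cosine and sine of \<open>arctan t\<close>.\<close>

lemma
  assumes "network G"
  shows weight_resistance: "weight G l * resistance G l = cos (kappa G)"
    and weight_inductance: "weight G l * (freq G * inductance G l) = sin (kappa G)"
proof -
  have r: "resistance G l > 0" and x: "inductance G l = rho G * resistance G l"
    using assms by (metis network_def, metis network_def nonzero_divide_eq_eq less_irrefl)
  have "sqrt ((resistance G l)\<^sup>2 + (freq G)\<^sup>2 * (inductance G l)\<^sup>2)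
      = sqrt ((resistance G l)\<^sup>2 * (1 + (rho G * freq G)\<^sup>2))"
    by (simp add: x algebra_simps)
  then have w: "weight G l = 1 / (resistance G l * sqrt (1 + (rho G * freq G)\<^sup>2))"
    using r by (simp add: weight_def real_sqrt_mult)
  show "weight G l * resistance G l = cos (kappa G)"
    and "weight G l * (freq G * inductance G l) = sin (kappa G)"
    using r by (simp_all add: w x kappa_def cos_arctan sin_arctan)
qed

text \<open>Weighting by the cosine and sine of the impedance angle cancels the terms in the sine of
  the voltage angle and gives the remaining terms the coefficient 1.\<close>

lemma branch_power_combination:
  assumes "network G" "consistent G p q v \<theta> P Q" "adjacent G j k"
  shows "cos (kappa G) * P j k + sin (kappa G) * Q j k
    = Y_edge G j k * ((v k)\<^sup>2 - v k * v j * cos (angle \<theta> j k))"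
proof -
  let ?Y = "Y_edge G j k"
  let ?a = "angle \<theta> j k"
  note wr = weight_resistance[OF assms(1), of "line_of G j k"]
  note wl = weight_inductance[OF assms(1), of "line_of G j k"]
  \<comment> \<open>One factor of the squared weight is paired with each resistance or reactance, so
    that \<open>wr\<close> and \<open>wl\<close> can replace the products.\<close>
  have "P j k = ?Y * ((v k)\<^sup>2 * (?Y * r_edge G j k)
      - v k * v j * ((?Y * r_edge G j k) * cos ?a + (?Y * (freq G * l_edge G j k)) * sin ?a))"
    and "Q j k = ?Y * ((v k)\<^sup>2 * (?Y * (freq G * l_edge G j k))
      - v k * v j * ((?Y * (freq G * l_edge G j k)) * cos ?a - (?Y * r_edge G j k) * sin ?a))"
    using assms(2,3) by (simp_all add: consistent_def power2_eq_square algebra_simps)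
  \<comment> \<open>With the sum of squares kept as an explicit factor, the claim is a polynomial
    identity that does not rely on Pythagoras.\<close>
  then have "cos (kappa G) * P j k + sin (kappa G) * Q j k
      = ?Y * ((sin (kappa G))\<^sup>2 + (cos (kappa G))\<^sup>2) * ((v k)\<^sup>2 - v k * v j * cos ?a)"
    unfolding wr wl by algebra
  then show ?thesis
    by simp
qed

text \<open>This is the triangle inequality for the combined branch power; cosine and sine of
  \<open>kappa G\<close> are nonnegative and so leave the absolute values.\<close>

lemma voltage_deviation_le_branch_power:
  assumes "network G" "consistent G p q v \<theta> P Q" "adjacent G j k" "v k > 0"
  shows "Y_edge G j k * \<bar>1 - v j / v k * cos (angle \<theta> j k)\<bar>
    \<le> cos (kappa G) / (v k)\<^sup>2 * \<bar>P j k\<bar> + sin (kappa G) / (v k)\<^sup>2 * \<bar>Q j k\<bar>"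
proof -
  have "1 - v j / v k * cos (angle \<theta> j k) = ((v k)\<^sup>2 - v k * v j * cos (angle \<theta> j k)) / (v k)\<^sup>2"
    using assms(4) by (simp add: field_simps power2_eq_square)
  then have "Y_edge G j k * \<bar>1 - v j / v k * cos (angle \<theta> j k)\<bar>
      = \<bar>cos (kappa G) * P j k + sin (kappa G) * Q j k\<bar> / (v k)\<^sup>2"
    using weight_pos[OF assms(1), of "line_of G j k"]
    by (simp add: branch_power_combination[OF assms(1-3)] abs_mult)
  also have "\<dots> \<le> (cos (kappa G) * \<bar>P j k\<bar> + sin (kappa G) * \<bar>Q j k\<bar>) / (v k)\<^sup>2"
    using abs_triangle_ineq[of "cos (kappa G) * P j k" "sin (kappa G) * Q j k"]
      cos_kappa_pos[of G] sin_kappa_nonneg[OF assms(1)]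
    by (intro divide_right_mono) (simp_all add: abs_mult)
  finally show ?thesis
    by (simp add: add_divide_distrib)
qed

section \<open>Row sums and norm of the Laplacian\<close>

definition other_node :: "('n, 'm) network \<Rightarrow> 'n \<Rightarrow> 'm \<Rightarrow> 'n" where
  "other_node G k l = (if tail_node G l = k then head_node G l else tail_node G l)"

text \<open>\<open>d_max\<close> sums over neighbors, the Laplacian over lines. Since no two lines
  join the same pair, \<open>line_of\<close> inverts \<open>other_node\<close> on the lines at
  \<open>k\<close>, which justifies the reindexing.\<close>

lemma sum_incident_le_d_max:
  fixes G :: "('n::finite, 'm::finite) network"
  assumes "network G"
  shows "(\<Sum>l\<in>{l. k \<in> {tail_node G l, head_node G l}}. weight G l) \<le> d_max G"
proof -
  let ?I = "{l. k \<in> {tail_node G l, head_node G l}}"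
  have joins: "joins G l (other_node G k l) k" if "l \<in> ?I" for l
    using that by (auto simp: joins_def other_node_def)
  have line: "line_of G (other_node G k l) k = l" if "l \<in> ?I" for l
    using joins_line_of[OF assms joins[OF that]] .
  have "(\<Sum>l\<in>?I. weight G l) = (\<Sum>l\<in>?I. Y_edge G (other_node G k l) k)"
    by (rule sum.cong) (simp_all only: line)
  also have "\<dots> = (\<Sum>j\<in>other_node G k ` ?I. Y_edge G j k)"
    using inj_on_inverseI[of ?I "\<lambda>j. line_of G j k"] line by (subst sum.reindex) auto
  also have "\<dots> \<le> (\<Sum>j\<in>nbrs G k. Y_edge G j k)"
    using joins weight_pos[OF assms]
    by (intro sum_mono2) (auto simp: nbrs_def adjacent_def less_imp_le)
  also have "\<dots> \<le> d_max G"
    by (simp add: d_max_def)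
  finally show ?thesis .
qed

lemma laplacian_nth:
  "laplacian G $ i $ j = (\<Sum>l\<in>UNIV. weight G l * incidence G $ i $ l * incidence G $ j $ l)"
  by (simp add: laplacian_def matrix_matrix_mult_def diag_matrix_def transpose_def mult_ac
      if_distrib[of "\<lambda>x. _ * x"] cong: if_cong)

lemma laplacian_sym: "laplacian G $ i $ j = laplacian G $ j $ i"
  by (simp add: laplacian_nth mult_ac)

lemma sum_abs_incidence:
  assumes "network G"
  shows "(\<Sum>j\<in>UNIV. \<bar>incidence G $ j $ l\<bar>) = 2"
proof -
  have ne: "tail_node G l \<noteq> head_node G l"
    using assms by (simp add: network_def)
  have "(\<Sum>j\<in>UNIV. \<bar>incidence G $ j $ l\<bar>) = (\<Sum>j\<in>{tail_node G l, head_node G l}. 1)"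
    by (rule sum.mono_neutral_cong_right) (auto simp: incidence_def)
  then show ?thesis
    using ne by simp
qed

text \<open>A line at \<open>k\<close> contributes at most its weight to the diagonal entry and to
  one other entry of the row, hence the factor 2.\<close>

lemma laplacian_row_sum:
  fixes G :: "('n::finite, 'm::finite) network"
  assumes "network G"
  shows "(\<Sum>j\<in>UNIV. \<bar>laplacian G $ k $ j\<bar>) \<le> 2 * d_max G"
proof -
  have "(\<Sum>j\<in>UNIV. \<bar>laplacian G $ k $ j\<bar>)
      \<le> (\<Sum>j\<in>UNIV. \<Sum>l\<in>UNIV. weight G l * \<bar>incidence G $ k $ l\<bar> * \<bar>incidence G $ j $ l\<bar>)"
    unfolding laplacian_nth
    using weight_pos[OF assms] by (intro sum_mono order_trans[OF sum_abs]) (simp add: abs_mult less_imp_le)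
  also have "\<dots> = (\<Sum>l\<in>UNIV. weight G l * \<bar>incidence G $ k $ l\<bar> * (\<Sum>j\<in>UNIV. \<bar>incidence G $ j $ l\<bar>))"
    by (subst sum.swap) (simp add: sum_distrib_left)
  also have "\<dots> = 2 * (\<Sum>l\<in>UNIV. weight G l * \<bar>incidence G $ k $ l\<bar>)"
    by (simp add: sum_abs_incidence[OF assms] sum_distrib_left mult_ac)
  also have "(\<Sum>l\<in>UNIV. weight G l * \<bar>incidence G $ k $ l\<bar>)
      = (\<Sum>l\<in>{l. k \<in> {tail_node G l, head_node G l}}. weight G l)"
    by (rule sum.mono_neutral_cong_right) (auto simp: incidence_def)
  also note sum_incident_le_d_max[OF assms]
  finally show ?thesis
    by simp
qed

lemma norm2_laplacian2: "network G \<Longrightarrow> norm2 (laplacian2 G) \<le> 2 * d_max G"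
  unfolding laplacian2_def
  by (rule norm2_kron_mat_1) (simp_all add: laplacian_row_sum laplacian_sym[of G _ j for j])

lemma laplacian_diag_pos:
  fixes G :: "('n::finite, 'm::finite) network"
  assumes "network G"
  shows "laplacian G $ head_node G l $ head_node G l > 0"
  unfolding laplacian_nth using weight_pos[OF assms]
  by (intro sum_pos2[of _ l]) (auto simp: incidence_def less_imp_le)

lemma d_max_pos:
  fixes G :: "('n::finite, 'm::finite) network"
  assumes "network G"
  shows "d_max G > 0"
proof -
  \<comment> \<open>Types are inhabited, so a line can be taken; it is incident to its own
    head.\<close>
  fix l :: 'm
  have "0 < (\<Sum>l'\<in>{l'. head_node G l \<in> {tail_node G l', head_node G l'}}. weight G l')"
    using weight_pos[OF assms] by (intro sum_pos) auto
  also note sum_incident_le_d_max[OF assms]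
  finally show ?thesis .
qed

section \<open>The admittance matrix and the matrix K of set-points\<close>

lemma matrix_inv_unique:
  fixes A :: "real ^ 'n::finite ^ 'n"
  assumes "A ** B = mat 1"
  shows "matrix_inv A = B"
proof -
  have "B ** A = mat 1"
    using assms by (simp add: matrix_left_right_inverse)
  then have "invertible A"
    using assms by (auto simp: invertible_def)
  then have "matrix_inv A ** A = mat 1"
    unfolding invertible_def matrix_inv_def by (rule someI2_ex) simp
  then have "matrix_inv A ** (A ** B) = B"
    by (simp add: matrix_mul_assoc)
  then show ?thesis
    by (simp add: assms)
qed

lemma Z_T_eq:
  assumes "network G"
  shows "Z_T G = diag_matrix (\<lambda>l. 1 / weight G l) \<otimes>\<^sub>K rot (kappa G)"
proof -
  have "resistance G l = cos (kappa G) / weight G l"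
    and "freq G * inductance G l = sin (kappa G) / weight G l" for l
    using weight_pos[OF assms, of l] weight_resistance[OF assms, of l] weight_inductance[OF assms, of l]
    by (simp_all add: field_simps)
  then show ?thesis
    unfolding Z_T_def R_T_def L_T_def kron_mult matrix_mul_lid matrix_mul_rid
    by (auto simp: vec_eq_iff kron_def diag_matrix_def mat_def J2_def rot_def forall_2)
qed

text \<open>The inverse of \<open>Z_T\<close> keeps the Kronecker form, so the rotation passes
  through the incidence matrices. It is split off as a block diagonal factor to suit
  submultiplicativity of the norm.\<close>

lemma admittance_eq:
  assumes "network G"
  shows "admittance G = laplacian2 G ** block_diag (\<lambda>_. rot (- kappa G))"
proof -
  have "(1 / weight G l) * weight G l = 1" for l
    using weight_pos[OF assms, of l] by simp
  then have "diag_matrix (\<lambda>l. 1 / weight G l) ** diag_matrix (weight G) = mat 1"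
    by (simp add: diag_matrix_mult) (simp add: diag_matrix_def mat_def)
  then have inv: "matrix_inv (Z_T G) = diag_matrix (weight G) \<otimes>\<^sub>K rot (- kappa G)"
    by (intro matrix_inv_unique)
      (simp add: Z_T_eq[OF assms] kron_mult rot_inverse kron_mat_1)
  show ?thesis
    unfolding admittance_def incidence2_def inv laplacian2_def laplacian_def
      mat_1_kron[symmetric] transpose_kron kron_mult
    by simp
qed

lemma norm2_rot_block: "norm2 (block_diag (\<lambda>_ :: 'n::finite. rot x)) \<le> 1"
proof (rule norm2_block_diag)
  show "(norm (rot x *v y))\<^sup>2 \<le> 1\<^sup>2 * (norm y)\<^sup>2" for y
    using norm_scaled_rotation_mult[of "cos x" "- sin x" y] unfolding rot_def by simp
qed simp

lemma norm2_admittance: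
  assumes "network G"
  shows "norm2 (admittance G) \<le> 2 * d_max G"
proof -
  have "norm2 (admittance G) \<le> norm2 (laplacian2 G) * norm2 (block_diag (\<lambda>_ :: 'a. rot (- kappa G)))"
    unfolding admittance_eq[OF assms] by (rule norm2_mult_le)
  also have "\<dots> \<le> norm2 (laplacian2 G) * 1"
    by (intro mult_left_mono norm2_rot_block norm2_nonneg)
  finally show ?thesis
    using norm2_laplacian2[OF assms] by simp
qed

text \<open>The norm occurs in a denominator: were it 0, the quotient bounding \<eta> would be 0 by
  convention, and no positive \<eta> could satisfy the bound.\<close>

lemma norm2_admittance_pos:
  fixes G :: "('n::finite, 'm::finite) network"
  assumes "network G"
  shows "norm2 (admittance G) > 0"
proof -
  fix l :: 'm
  \<comment> \<open>The diagonal entries of \<open>rot (- kappa G)\<close> are the positive number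
    \<open>cos (kappa G)\<close>, so a diagonal position exhibits a nonzero entry.\<close>
  let ?k = "(head_node G l, 1 :: 2)"
  have "admittance G = laplacian G \<otimes>\<^sub>K rot (- kappa G)"
    by (simp add: admittance_eq[OF assms] laplacian2_def kron_mult flip: mat_1_kron)
  then have "admittance G $ ?k $ ?k = laplacian G $ head_node G l $ head_node G l * cos (kappa G)"
    by (simp add: kron_def rot_def)
  also have "\<dots> > 0"
    by (intro mult_pos_pos laplacian_diag_pos[OF assms] cos_kappa_pos)
  finally show ?thesis
    by (auto simp: norm2_pos_iff)
qed

text \<open>Matrices with rows \<open>(a, b)\<close> and \<open>(-b, a)\<close> represent complex
  numbers; multiplication by \<open>rot (kappa G)\<close> preserves this form and the
  modulus.\<close>

lemma norm2_K_matrix: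
  "norm2 (K_matrix G p q v) \<le> Max (range (\<lambda>k. sqrt ((p k)\<^sup>2 + (q k)\<^sup>2) / (v k)\<^sup>2))"
  unfolding K_matrix_def
proof (rule norm2_block_diag)
  let ?s = "\<lambda>k. sqrt ((p k)\<^sup>2 + (q k)\<^sup>2) / (v k)\<^sup>2"
  have s_le: "?s k \<le> Max (range ?s)" for k
    by (intro Max_ge) auto
  show "0 \<le> Max (range ?s)"
    by (rule order_trans[OF _ s_le]) simp
  fix k and y :: "real ^ 2"
  let ?a = "cos (kappa G) * p k + sin (kappa G) * q k"
  let ?b = "cos (kappa G) * q k - sin (kappa G) * p k"
  have "?a\<^sup>2 + ?b\<^sup>2 = ((sin (kappa G))\<^sup>2 + (cos (kappa G))\<^sup>2) * ((p k)\<^sup>2 + (q k)\<^sup>2)"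
    by algebra
  then have ab: "?a\<^sup>2 + ?b\<^sup>2 = (p k)\<^sup>2 + (q k)\<^sup>2"
    by simp
  have "rot (kappa G) ** (vector [vector [p k, q k], vector [- q k, p k]] :: real ^ 2 ^ 2)
      = vector [vector [?a, ?b], vector [- ?b, ?a]]"
    by (simp add: vec_eq_iff forall_2 matrix_matrix_mult_def sum_2 rot_def)
  then have "K_node G p q v k *v y
      = (1 / (v k)\<^sup>2) *\<^sub>R (vector [vector [?a, ?b], vector [- ?b, ?a]] *v y)"
    by (simp add: K_node_def scaleR_matrix_vector_assoc)
  then have "(norm (K_node G p q v k *v y))\<^sup>2 = (1 / (v k)\<^sup>2)\<^sup>2 * ((?a\<^sup>2 + ?b\<^sup>2) * (norm y)\<^sup>2)"
    by (simp only: norm_scaleR power_mult_distrib norm_scaled_rotation_mult power2_abs)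
  also have "\<dots> = (?s k)\<^sup>2 * (norm y)\<^sup>2"
    unfolding ab by (simp add: power_divide)
  also have "\<dots> \<le> (Max (range ?s))\<^sup>2 * (norm y)\<^sup>2"
    by (intro mult_right_mono power_mono s_le) auto
  finally show "(norm (K_node G p q v k *v y))\<^sup>2 \<le> (Max (range ?s))\<^sup>2 * (norm y)\<^sup>2" .
qed

section \<open>The margin and gain inequalities of the Stability Condition\<close>

theorem proposition2:
  fixes G :: "('n::finite, 'm::finite) network"
    and p q v \<theta> :: "'n \<Rightarrow> real"
    and P Q :: "'n \<Rightarrow> 'n \<Rightarrow> real"
    and c \<alpha> \<eta> :: real
  assumes "network G"
    and "\<And>k. v k > 0"
    and "c > 0" and "\<alpha> > 0" and "\<eta> > 0"
    and "consistent G p q v \<theta> P Q"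
    and "\<And>j k. \<bar>angle \<theta> j k\<bar> \<le> pi / 2"
    and "\<And>k. (\<Sum>j\<in>nbrs G k. cos (kappa G) / (v k)\<^sup>2 * \<bar>P j k\<bar> + sin (kappa G) / (v k)\<^sup>2 * \<bar>Q j k\<bar>) + \<alpha>
               < (v_min v)\<^sup>2 / (2 * (v_max v)\<^sup>2) * lambda2 (laplacian G) - c"
    and "\<eta> < c / (2 * rho G * d_max G *
                 (c + 5 * Max (range (\<lambda>k. sqrt ((p k)\<^sup>2 + (q k)\<^sup>2) / (v k)\<^sup>2)) + 10 * d_max G))"
  shows "stability_condition G p q v \<theta> c \<alpha> \<eta>"
proof -
  let ?s = "Max (range (\<lambda>k. sqrt ((p k)\<^sup>2 + (q k)\<^sup>2) / (v k)\<^sup>2))"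
  let ?N = "norm2 (K_matrix G p q v - laplacian2 G)"
  have margin: "(\<Sum>j\<in>nbrs G k. Y_edge G j k * \<bar>1 - v j / v k * cos (angle \<theta> j k)\<bar>) + \<alpha>
      < (1 + cos (pi / 2)) / 2 * ((v_min v)\<^sup>2 / (v_max v)\<^sup>2) * lambda2 (laplacian G) - c" for k
  proof -
    have "(\<Sum>j\<in>nbrs G k. Y_edge G j k * \<bar>1 - v j / v k * cos (angle \<theta> j k)\<bar>)
        \<le> (\<Sum>j\<in>nbrs G k. cos (kappa G) / (v k)\<^sup>2 * \<bar>P j k\<bar> + sin (kappa G) / (v k)\<^sup>2 * \<bar>Q j k\<bar>)"
      by (intro sum_mono voltage_deviation_le_branch_power[OF assms(1,6)])
        (simp_all add: nbrs_def assms(2))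
    with assms(8)[of k] show ?thesis
      by simp
  qed
  \<comment> \<open>Five times this bound produces the summands \<open>5 * ?s + 10 * d_max G\<close>
    of the hypothesis on \<eta>.\<close>
  have "?N \<le> ?s + 2 * d_max G"
    using norm2_diff_le[of "K_matrix G p q v" "laplacian2 G"] norm2_K_matrix[of G p q v]
      norm2_laplacian2[OF assms(1)] by linarith
  then have "norm2 (admittance G) * (c + 5 * ?N) \<le> 2 * d_max G * (c + 5 * ?s + 10 * d_max G)"
    using d_max_pos[OF assms(1)] norm2_nonneg[of "K_matrix G p q v - laplacian2 G"] assms(3)
    by (intro mult_mono norm2_admittance assms(1)) auto
  moreover have "rho G > 0"
    using assms(1) by (simp add: network_def)
  \<comment> \<open>Comparing the quotients requires the smaller denominator to be strictly
    positive.\<close>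
  moreover have "norm2 (admittance G) * (c + 5 * ?N) > 0"
    using norm2_admittance_pos[OF assms(1)] norm2_nonneg[of "K_matrix G p q v - laplacian2 G"] assms(3)
    by (intro mult_pos_pos) auto
  ultimately have "c / (rho G * (2 * d_max G * (c + 5 * ?s + 10 * d_max G)))
      \<le> c / (rho G * (norm2 (admittance G) * (c + 5 * ?N)))"
    using assms(3) by (intro frac_le) auto
  with assms(9) have "\<eta> < c / (rho G * norm2 (admittance G) * (c + 5 * ?N))"
    by (simp add: mult_ac)
  moreover have "\<exists>\<theta>'. 0 \<le> \<theta>' \<and> \<theta>' \<le> pi / 2 \<and> (\<forall>j k. \<bar>angle \<theta> j k\<bar> \<le> \<theta>') \<and>
      (\<forall>k. (\<Sum>j\<in>nbrs G k. Y_edge G j k * \<bar>1 - v j / v k * cos (angle \<theta> j k)\<bar>) + \<alpha>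
        < (1 + cos \<theta>') / 2 * ((v_min v)\<^sup>2 / (v_max v)\<^sup>2) * lambda2 (laplacian G) - c)"
    using margin assms(7) by (intro exI[of _ "pi / 2"]) simp
  ultimately show ?thesis
    using assms(6) unfolding stability_condition_def by blast
qed

end
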